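(* Let $(\mathcal K,r_n,\xi)$ be a Cayley extender. The symmetry type graph of $\mathcal K_{r_n}^\xi$ is a quotient $\mathcal K_{r_n}/H$ of $\mathcal K_{r_n}$ by some $r_n$-friendly subgroup $H\le\heartsuit(\mathcal K,r_n)$.
   Context: An $n$-premaniplex is a graph (semi-edges and parallel edges allowed) whose vertices, called flags, carry a proper edge colouring with colours $0,\dots,n-1$, each flag $\Phi$ having exactly one incident dart of each colour $i$, with other end $r_i\Phi$; one requires $r_ir_jr_ir_j=1$ for $|i-j|>1$. An $n$-maniplex is a connected $n$-premaniplex in which $r_i$ and $r_ir_j$ ($i\ne j$) have no fixed points. Facets are components after deleting colour-$(n-1)$ edges. Automorphisms are colour-preserving and act on the right; $\Gamma(\cdot)$ is the automorphism group. The symmetry type graph of $\mathcal M$ is $\mathcal M/\Gamma(\mathcal M)$ (vertices are flag orbits; the orbit of $\Phi$ is $i$-adjacent to the orbit of $r_i\Phi$). A Cayley extender is a triple $(\mathcal K,r_n,\xi)$: $\mathcal K$ an $n$-maniplex; $r_n$ a permutation of its flags with $r_n^2=1$ commuting with $r_0,\dots,r_{n-2}$; $\xi$ a function from the facets of $\mathcal K$ to a group $G$ with $\xi(r_n(F))=\xi(F)^{-1}$; it is assumed $\{\xi(F)\}$ generates $G$ and $\xi(F)\neq1$ whenever $r_n|_F=\mathrm{id}$ or $r_n\Phi=r_i\Phi$ for some $\Phi\in F$, $i<n$. The pre-extension $\mathcal K_{r_n}$ is the $(n+1)$-premaniplex with the flags and $i$-adjacencies ($i<n$) of $\mathcal K$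 and $n$-adjacency $\Phi\mapsto r_n\Phi$. The derived maniplex $\mathcal K_{r_n}^\xi$ has flags $(\Phi,\gamma)$, $\gamma\in G$, with $(\Phi,\gamma)$ $i$-adjacent to $(r_i\Phi,\gamma)$ for $i<n$ and $n$-adjacent to $(r_n\Phi,\xi(F)\gamma)$, $F$ the facet of $\Phi$. A subset $S\subseteq\Gamma(\mathcal K)$ is $r_n$-friendly if for every flag $\Phi$ and every $\tau\in S$ there is $\bar\tau\in S$ with $r_n(\Phi\tau)=(r_n\Phi)\bar\tau$. $\heartsuit(\mathcal K,r_n)$ is the union of all $r_n$-friendly subsets (a subgroup of $\Gamma(\mathcal K)$). For an $r_n$-friendly subgroup $H$, $\mathcal K_{r_n}/H$ is the premaniplex with vertices the orbits $\Phi H$, where $\Phi H$ is $i$-adjacent to $(r_i\Phi)H$ for $0\le i\le n$. *)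

theory Defs
  imports "HOL-Algebra.Generated_Groups"
begin

text \<open>
  A properly edge-coloured graph with exactly one dart of each colour \<open>i < rank M\<close> at every flag
  is given by its flags and by the maps \<open>adj M i\<close>, taking a flag to the other end of its dart of
  colour \<open>i\<close>. A fixed point of \<open>adj M i\<close> is a semi-edge. The values of \<open>adj M i\<close>
  for \<open>i \<ge> rank M\<close> or outside \<open>flags M\<close> carry no meaning.
\<close>

record 'a coloured_graph =
  rank :: nat
  flags :: "'a set"
  adj :: "nat \<Rightarrow> 'a \<Rightarrow> 'a"

definition component :: "'a coloured_graph \<Rightarrow> nat set \<Rightarrow> 'a \<Rightarrow> 'a set" where
  "component M I \<Phi> = {(\<Psi>, adj M i \<Psi>) | \<Psi> i. \<Psi> \<in> flags M \<and> i \<in> I}\<^sup>* `` {\<Phi>}"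

definition facet_of :: "'a coloured_graph \<Rightarrow> 'a \<Rightarrow> 'a set" where
  "facet_of M \<Phi> = component M {..<rank M - 1} \<Phi>"

definition facets :: "'a coloured_graph \<Rightarrow> 'a set set" where
  "facets M = facet_of M ` flags M"

locale premaniplex =
  fixes n :: nat and M :: "'a coloured_graph"
  assumes rank_eq: "rank M = n"
    and adj_closed: "\<lbrakk>i < n; \<Phi> \<in> flags M\<rbrakk> \<Longrightarrow> adj M i \<Phi> \<in> flags M"
    and adj_invol: "\<lbrakk>i < n; \<Phi> \<in> flags M\<rbrakk> \<Longrightarrow> adj M i (adj M i \<Phi>) = \<Phi>"
    and adj_far: "\<lbrakk>i < n; j < n; \<bar>int i - int j\<bar> > 1; \<Phi> \<in> flags M\<rbrakk>
      \<Longrightarrow> adj M i (adj M j (adj M i (adj M j \<Phi>))) = \<Phi>"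

locale maniplex = premaniplex +
  assumes flags_nonempty: "flags M \<noteq> {}"
    and connected: "\<Phi> \<in> flags M \<Longrightarrow> component M {..<n} \<Phi> = flags M"
    and adj_no_fix: "\<lbrakk>i < n; \<Phi> \<in> flags M\<rbrakk> \<Longrightarrow> adj M i \<Phi> \<noteq> \<Phi>"
    and adj_adj_no_fix: "\<lbrakk>i < n; j < n; i \<noteq> j; \<Phi> \<in> flags M\<rbrakk> \<Longrightarrow> adj M i (adj M j \<Phi>) \<noteq> \<Phi>"

definition iso_graph :: "'a coloured_graph \<Rightarrow> 'b coloured_graph \<Rightarrow> ('a \<Rightarrow> 'b) \<Rightarrow> bool" where
  "iso_graph M N f \<longleftrightarrow> rank M = rank N \<and> bij_betw f (flags M) (flags N) \<and>
     (\<forall>i<rank M. \<forall>\<Phi>\<in>flags M. f (adj M i \<Phi>) = adj N i (f \<Phi>))"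

definition isomorphic_graphs :: "'a coloured_graph \<Rightarrow> 'b coloured_graph \<Rightarrow> bool"
    (infix \<open>\<simeq>\<close> 50) where
  "M \<simeq> N \<longleftrightarrow> (\<exists>f. iso_graph M N f)"

text \<open>
  The image written \<open>\<Phi>\<tau>\<close> for the right action is \<open>\<tau> \<Phi>\<close> here; the product \<open>\<sigma>\<tau>\<close> is
  \<open>\<sigma>\<close> followed by \<open>\<tau>\<close>. Automorphisms are made \<open>extensional\<close> so that
  they are determined by their action on flags.
\<close>

definition aut_group :: "'a coloured_graph \<Rightarrow> ('a \<Rightarrow> 'a) monoid" (\<open>\<Gamma>\<close>) where
  "\<Gamma> M = \<lparr>carrier = {\<tau> \<in> extensional (flags M). iso_graph M M \<tau>},
          mult = (\<lambda>\<sigma> \<tau>. compose (flags M) \<tau> \<sigma>),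
          one = (\<lambda>\<Phi>\<in>flags M. \<Phi>)\<rparr>"

definition orb :: "('a \<Rightarrow> 'a) set \<Rightarrow> 'a \<Rightarrow> 'a set" where
  "orb H \<Phi> = (\<lambda>\<tau>. \<tau> \<Phi>) ` H"

text \<open>
  The union in \<open>quotient_graph\<close> is over all representatives of an orbit; whenever the orbit of
  \<open>adj M i \<Phi>\<close> depends only on the orbit of \<open>\<Phi>\<close>, it is that orbit
  (see \<open>quotient_graph_adj\<close> and \<open>quotient_pre_extension_adj\<close> below).
\<close>

definition quotient_graph :: "'a coloured_graph \<Rightarrow> ('a \<Rightarrow> 'a) set \<Rightarrow> 'a set coloured_graph" where
  "quotient_graph M H = \<lparr>rank = rank M, flags = orb H ` flags M,
                   adj = (\<lambda>i X. \<Union>\<Phi>\<in>X. orb H (adj M i \<Phi>))\<rparr>"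

definition symmetry_type_graph :: "'a coloured_graph \<Rightarrow> 'a set coloured_graph" where
  "symmetry_type_graph M = quotient_graph M (carrier (\<Gamma> M))"

locale cayley_extender = K: maniplex n K + G: group G
  for n :: nat and K :: "'a coloured_graph" and r :: "'a \<Rightarrow> 'a"
    and G :: "('g, 'm) monoid_scheme" (structure) and \<xi> :: "'a set \<Rightarrow> 'g" +
  assumes r_bij: "bij_betw r (flags K) (flags K)"
    and r_invol: "\<Phi> \<in> flags K \<Longrightarrow> r (r \<Phi>) = \<Phi>"
    and r_commutes: "\<lbrakk>i + 1 < n; \<Phi> \<in> flags K\<rbrakk> \<Longrightarrow> r (adj K i \<Phi>) = adj K i (r \<Phi>)"
    and xi_closed: "\<xi> \<in> facets K \<rightarrow> carrier G"
    and xi_inv: "F \<in> facets K \<Longrightarrow> \<xi> (r ` F) = inv (\<xi> F)"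
    and xi_generates: "generate G (\<xi> ` facets K) = carrier G"
    and xi_nontriv_id: "\<lbrakk>F \<in> facets K; \<forall>\<Phi>\<in>F. r \<Phi> = \<Phi>\<rbrakk> \<Longrightarrow> \<xi> F \<noteq> \<one>"
    and xi_nontriv_adj: "\<lbrakk>F \<in> facets K; \<Phi> \<in> F; i < n; r \<Phi> = adj K i \<Phi>\<rbrakk> \<Longrightarrow> \<xi> F \<noteq> \<one>"

definition pre_extension :: "'a coloured_graph \<Rightarrow> ('a \<Rightarrow> 'a) \<Rightarrow> 'a coloured_graph" where
  "pre_extension K r = \<lparr>rank = rank K + 1, flags = flags K,
                        adj = (\<lambda>i. if i < rank K then adj K i else r)\<rparr>"

definition derived_maniplex :: "'a coloured_graph \<Rightarrow> ('a \<Rightarrow> 'a) \<Rightarrow> ('g, 'm) monoid_scheme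
    \<Rightarrow> ('a set \<Rightarrow> 'g) \<Rightarrow> ('a \<times> 'g) coloured_graph" where
  "derived_maniplex K r G \<xi> = \<lparr>rank = rank K + 1, flags = flags K \<times> carrier G,
     adj = (\<lambda>i (\<Phi>, \<gamma>). if i < rank K then (adj K i \<Phi>, \<gamma>)
                       else (r \<Phi>, \<xi> (facet_of K \<Phi>) \<otimes>\<^bsub>G\<^esub> \<gamma>))\<rparr>"

definition friendly :: "'a coloured_graph \<Rightarrow> ('a \<Rightarrow> 'a) \<Rightarrow> ('a \<Rightarrow> 'a) set \<Rightarrow> bool" where
  "friendly K r S \<longleftrightarrow> S \<subseteq> carrier (\<Gamma> K) \<and>
     (\<forall>\<Phi>\<in>flags K. \<forall>\<tau>\<in>S. \<exists>\<tau>'\<in>S. r (\<tau> \<Phi>) = \<tau>' (r \<Phi>))"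

definition heart :: "'a coloured_graph \<Rightarrow> ('a \<Rightarrow> 'a) \<Rightarrow> ('a \<Rightarrow> 'a) set" (\<open>\<heartsuit>\<close>) where
  "\<heartsuit> K r = \<Union>{S. friendly K r S}"

lemma aut_adj:
  "\<lbrakk>\<tau> \<in> carrier (\<Gamma> M); i < rank M; \<Phi> \<in> flags M\<rbrakk> \<Longrightarrow> \<tau> (adj M i \<Phi>) = adj M i (\<tau> \<Phi>)"
  by (simp add: aut_group_def iso_graph_def)

lemma aut_closed: "\<lbrakk>\<tau> \<in> carrier (\<Gamma> M); \<Phi> \<in> flags M\<rbrakk> \<Longrightarrow> \<tau> \<Phi> \<in> flags M"
  by (auto simp: aut_group_def iso_graph_def bij_betw_def)

lemma iso_graph_inv:
  assumes "premaniplex n M" "iso_graph M M \<tau>"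
  shows "iso_graph M M (restrict (inv_into (flags M) \<tau>) (flags M))"
proof -
  interpret premaniplex n M by fact
  have b: "bij_betw \<tau> (flags M) (flags M)" using assms(2) by (simp add: iso_graph_def)
  have "inv_into (flags M) \<tau> (adj M i \<Phi>) = adj M i (inv_into (flags M) \<tau> \<Phi>)"
    if "i < n" "\<Phi> \<in> flags M" for i \<Phi>
  proof -
    have c: "inv_into (flags M) \<tau> \<Phi> \<in> flags M"
      using b that by (metis bij_betw_def inv_into_into)
    have "\<tau> (adj M i (inv_into (flags M) \<tau> \<Phi>)) = adj M i \<Phi>"
      using assms(2) c that b rank_eq by (simp add: iso_graph_def bij_betw_inv_into_right)
    then show ?thesis
      using adj_closed[OF that(1) c] b by (metis bij_betw_inv_into_left)
  qed
  then show ?thesis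
    using bij_betw_inv_into[OF b] rank_eq adj_closed
    by (simp add: iso_graph_def cong: bij_betw_cong)
qed

lemma group_aut_group:
  assumes "premaniplex n M"
  shows "group (\<Gamma> M)"
proof -
  interpret premaniplex n M by fact
  have comp: "compose (flags M) \<tau> \<sigma> \<in> carrier (\<Gamma> M)"
    if "\<sigma> \<in> carrier (\<Gamma> M)" "\<tau> \<in> carrier (\<Gamma> M)" for \<sigma> \<tau>
  proof -
    have "bij_betw (compose (flags M) \<tau> \<sigma>) (flags M) (flags M)"
      using that by (auto simp: aut_group_def iso_graph_def intro: bij_betw_compose)
    then show ?thesis
      using that adj_closed rank_eq aut_closed[of \<sigma> M]
      by (simp add: aut_group_def iso_graph_def) (simp add: compose_def)
  qed
  have one: "\<one>\<^bsub>\<Gamma> M\<^esub> \<in> carrier (\<Gamma> M)"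
    using adj_closed rank_eq by (auto simp: aut_group_def iso_graph_def bij_betw_def inj_on_def)
  show ?thesis
  proof (rule groupI)
    fix \<tau> assume t: "\<tau> \<in> carrier (\<Gamma> M)"
    then have b: "iso_graph M M \<tau>" by (simp add: aut_group_def)
    let ?\<sigma> = "restrict (inv_into (flags M) \<tau>) (flags M)"
    have "?\<sigma> \<in> carrier (\<Gamma> M)"
      using iso_graph_inv[OF assms b] by (simp add: aut_group_def)
    moreover have "?\<sigma> \<otimes>\<^bsub>\<Gamma> M\<^esub> \<tau> = \<one>\<^bsub>\<Gamma> M\<^esub>"
      using b by (auto simp: aut_group_def iso_graph_def compose_def bij_betw_inv_into_right
          intro!: restrict_ext)
    ultimately show "\<exists>\<sigma>\<in>carrier (\<Gamma> M). \<sigma> \<otimes>\<^bsub>\<Gamma> M\<^esub> \<tau> = \<one>\<^bsub>\<Gamma> M\<^esub>"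
      by blast
  next
    fix \<sigma> \<tau> assume "\<sigma> \<in> carrier (\<Gamma> M)" "\<tau> \<in> carrier (\<Gamma> M)"
    then show "\<sigma> \<otimes>\<^bsub>\<Gamma> M\<^esub> \<tau> \<in> carrier (\<Gamma> M)"
      using comp by (simp add: aut_group_def)
  next
    fix \<rho> \<sigma> \<tau> assume "\<rho> \<in> carrier (\<Gamma> M)"
    then show "\<rho> \<otimes>\<^bsub>\<Gamma> M\<^esub> \<sigma> \<otimes>\<^bsub>\<Gamma> M\<^esub> \<tau> = \<rho> \<otimes>\<^bsub>\<Gamma> M\<^esub> (\<sigma> \<otimes>\<^bsub>\<Gamma> M\<^esub> \<tau>)"
      using aut_closed[of \<rho> M]
      by (simp add: aut_group_def) (simp add: compose_def cong: restrict_cong)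
  next
    fix \<tau> assume t: "\<tau> \<in> carrier (\<Gamma> M)"
    then have "\<tau> \<in> extensional (flags M)" by (simp add: aut_group_def)
    then have "restrict \<tau> (flags M) = \<tau>" by (rule extensional_restrict)
    then show "\<one>\<^bsub>\<Gamma> M\<^esub> \<otimes>\<^bsub>\<Gamma> M\<^esub> \<tau> = \<tau>"
      by (simp add: aut_group_def compose_def cong: restrict_cong)
  qed (rule one)
qed

lemma orb_trans:
  assumes "premaniplex n M" "subgroup H (\<Gamma> M)" "\<tau> \<in> H" "\<Phi> \<in> flags M"
  shows "orb H (\<tau> \<Phi>) = orb H \<Phi>"
proof -
  interpret group "\<Gamma> M" by (rule group_aut_group) fact
  interpret H: subgroup H "\<Gamma> M" by fact
  have 1: "orb H (\<tau> \<Phi>) \<subseteq> orb H \<Phi>" if "\<tau> \<in> H" "\<Phi> \<in> flags M" for \<tau> \<Phi>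
  proof -
    have "\<sigma> (\<tau> \<Phi>) \<in> orb H \<Phi>" if "\<sigma> \<in> H" for \<sigma>
    proof -
      have "(\<tau> \<otimes>\<^bsub>\<Gamma> M\<^esub> \<sigma>) \<Phi> = \<sigma> (\<tau> \<Phi>)"
        using \<open>\<Phi> \<in> flags M\<close> by (simp add: aut_group_def compose_def)
      then show ?thesis
        using H.m_closed[OF \<open>\<tau> \<in> H\<close> that] unfolding orb_def by (metis imageI)
    qed
    then show ?thesis by (auto simp: orb_def)
  qed
  have "inv\<^bsub>\<Gamma> M\<^esub> \<tau> \<in> H" using assms(3) by (rule H.m_inv_closed)
  moreover have "(inv\<^bsub>\<Gamma> M\<^esub> \<tau>) (\<tau> \<Phi>) = \<Phi>"
  proof -
    have "(\<tau> \<otimes>\<^bsub>\<Gamma> M\<^esub> \<rho>) \<Phi> = \<rho> (\<tau> \<Phi>)" "\<one>\<^bsub>\<Gamma> M\<^esub> \<Phi> = \<Phi>" for \<rho>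
      using assms(4) by (simp_all add: aut_group_def compose_def)
    then show ?thesis
      using r_inv[OF H.mem_carrier[OF assms(3)]] by metis
  qed
  moreover have "\<tau> \<Phi> \<in> flags M" using assms(4) by (rule aut_closed[OF H.mem_carrier[OF assms(3)]])
  ultimately show ?thesis
    using 1[of "inv\<^bsub>\<Gamma> M\<^esub> \<tau>" "\<tau> \<Phi>"] 1[OF assms(3,4)] by (metis subset_antisym)
qed

lemma quotient_graph_adj:
  assumes "premaniplex n M" "subgroup H (\<Gamma> M)" "i < rank M" "\<Phi> \<in> flags M"
  shows "adj (quotient_graph M H) i (orb H \<Phi>) = orb H (adj M i \<Phi>)"
proof -
  interpret premaniplex n M by fact
  have H: "H \<subseteq> carrier (\<Gamma> M)" "H \<noteq> {}"
    using assms(2) subgroup.subset subgroup.one_closed by blast+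
  have "orb H (adj M i (\<tau> \<Phi>)) = orb H (adj M i \<Phi>)" if "\<tau> \<in> H" for \<tau>
    using orb_trans[OF assms(1,2) that, of "adj M i \<Phi>"] aut_adj[of \<tau> M i \<Phi>] H that assms
      adj_closed rank_eq by auto
  then show ?thesis using H by (auto simp: quotient_graph_def orb_def[of H \<Phi>])
qed

context cayley_extender
begin

lemma r_closed: "\<Phi> \<in> flags K \<Longrightarrow> r \<Phi> \<in> flags K"
  using r_bij by (auto dest: bij_betwE)

lemma quotient_pre_extension_adj:
  assumes "subgroup H (\<Gamma> K)" "friendly K r H" "i \<le> n" "\<Phi> \<in> flags K"
  shows "adj (quotient_graph (pre_extension K r) H) i (orb H \<Phi>) = orb H (adj (pre_extension K r) i \<Phi>)"
proof (cases "i < n")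
  case True
  then show ?thesis
    using quotient_graph_adj[OF K.premaniplex_axioms assms(1), of i \<Phi>] assms K.rank_eq
    by (simp add: quotient_graph_def pre_extension_def)
next
  case False
  have H: "H \<noteq> {}" using assms(1) subgroup.one_closed by blast
  have "orb H (r (\<tau> \<Phi>)) = orb H (r \<Phi>)" if t: "\<tau> \<in> H" for \<tau>
  proof -
    obtain \<tau>' where "\<tau>' \<in> H" "r (\<tau> \<Phi>) = \<tau>' (r \<Phi>)"
      using assms(2,4) t unfolding friendly_def by meson
    then show ?thesis
      using orb_trans[OF K.premaniplex_axioms assms(1)] r_closed[OF assms(4)] by simp
  qed
  then show ?thesis using H False K.rank_eq
    by (auto simp: quotient_graph_def pre_extension_def orb_def[of H \<Phi>])
qed

end

end

(*
  Deleting the edges of colour n from the derived maniplex leaves one copy of K, a layer, for each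
  element of G. Every automorphism of the derived maniplex permutes the layers, and on each layer
  it acts as an automorphism of K. H consists of all the automorphisms of K that arise so.
  Right translations by elements of G are automorphisms of the derived maniplex and permute the
  layers transitively, so H is a subgroup, any layer suffices to see all of H, and the projection
  to K identifies the flag orbits of the derived maniplex with the H-orbits on K.
*)
theory Submission
  imports Defs
begin

section \<open>Products of automorphisms, components and facets\<close>

lemma aut_mult_apply: "\<Phi> \<in> flags M \<Longrightarrow> (\<sigma> \<otimes>\<^bsub>\<Gamma> M\<^esub> \<tau>) \<Phi> = \<tau> (\<sigma> \<Phi>)"
  by (simp add: aut_group_def compose_def)

lemma aut_one_apply: "\<Phi> \<in> flags M \<Longrightarrow> \<one>\<^bsub>\<Gamma> M\<^esub> \<Phi> = \<Phi>"
  by (simp add: aut_group_def)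

lemma component_induct [consumes 1, case_names base step]:
  assumes "\<Psi> \<in> component M I \<Phi>" "P \<Phi>"
    and "\<And>\<Psi> i. \<lbrakk>\<Psi> \<in> flags M; i \<in> I; P \<Psi>\<rbrakk> \<Longrightarrow> P (adj M i \<Psi>)"
  shows "P \<Psi>"
proof -
  have "(\<Phi>, \<Psi>) \<in> {(\<Psi>, adj M i \<Psi>) | \<Psi> i. \<Psi> \<in> flags M \<and> i \<in> I}\<^sup>*"
    using assms(1) by (simp add: component_def)
  then show ?thesis
    by induction (use assms(2,3) in auto)
qed

lemma component_refl: "\<Phi> \<in> component M I \<Phi>"
  by (simp add: component_def)

lemma component_step:
  "\<lbrakk>\<Psi> \<in> component M I \<Phi>; \<Psi> \<in> flags M; i \<in> I\<rbrakk> \<Longrightarrow> adj M i \<Psi> \<in> component M I \<Phi>"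
  unfolding component_def by (auto intro: rtrancl_into_rtrancl)

lemma component_trans:
  "\<lbrakk>\<Psi> \<in> component M I \<Phi>; X \<in> component M I \<Psi>\<rbrakk> \<Longrightarrow> X \<in> component M I \<Phi>"
  unfolding component_def by (auto intro: rtrancl_trans)

text \<open>\<open>component\<close> is directed reachability, but adjacencies are involutions, so
  the step from \<Phi> can be retraced with the same colour. Each of the two flags is thus reachable
  from the other.\<close>

lemma (in premaniplex) component_adj:
  assumes "I \<subseteq> {..<n}" "i \<in> I" "\<Phi> \<in> flags M"
  shows "component M I (adj M i \<Phi>) = component M I \<Phi>"
proof -
  have i: "i < n" using assms by auto
  have "adj M i \<Phi> \<in> component M I \<Phi>"
    using assms component_refl by (metis component_step)
  moreover have "\<Phi> \<in> component M I (adj M i \<Phi>)"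
    using component_step[OF component_refl adj_closed[OF i assms(3)] assms(2)]
      adj_invol[OF i assms(3)] by simp
  ultimately show ?thesis by (auto intro: component_trans)
qed

text \<open>The bound reflects that facets delete colour \<open>n - 1\<close>, and it agrees with
  the bound in \<open>r_commutes\<close>. For a Cayley extender it means that these colours never
  change the value of \<xi>.\<close>

lemma (in premaniplex) facet_of_adj:
  "\<lbrakk>i + 1 < n; \<Phi> \<in> flags M\<rbrakk> \<Longrightarrow> facet_of M (adj M i \<Phi>) = facet_of M \<Phi>"
  unfolding facet_of_def by (rule component_adj) (auto simp: rank_eq)

lemma (in premaniplex) facet_of_subset: "\<Phi> \<in> flags M \<Longrightarrow> facet_of M \<Phi> \<subseteq> flags M"
proof
  fix \<Psi> assume "\<Phi> \<in> flags M" "\<Psi> \<in> facet_of M \<Phi>"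
  from this(2,1) show "\<Psi> \<in> flags M"
    unfolding facet_of_def by (induction rule: component_induct) (auto simp: rank_eq adj_closed)
qed

section \<open>The derived graph is a premaniplex of rank \<open>n + 1\<close>\<close>

context cayley_extender
begin

abbreviation D :: "('a \<times> 'g) coloured_graph" where
  "D \<equiv> derived_maniplex K r G \<xi>"

lemma D_rank: "rank D = n + 1"
  by (simp add: derived_maniplex_def K.rank_eq)

lemma D_flags: "flags D = flags K \<times> carrier G"
  by (simp add: derived_maniplex_def)

lemma D_adj_less: "i < n \<Longrightarrow> adj D i (\<Phi>, \<gamma>) = (adj K i \<Phi>, \<gamma>)"
  by (simp add: derived_maniplex_def K.rank_eq)

lemma D_adj_top: "adj D n (\<Phi>, \<gamma>) = (r \<Phi>, \<xi> (facet_of K \<Phi>) \<otimes> \<gamma>)"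
  by (simp add: derived_maniplex_def K.rank_eq)

lemma xi_facet_closed: "\<Phi> \<in> flags K \<Longrightarrow> \<xi> (facet_of K \<Phi>) \<in> carrier G"
  using xi_closed by (auto simp: facets_def)

text \<open>Since \<open>r\<close> commutes with the colours that connect a facet, it carries walks
  inside a facet to walks inside the facet of the image. This gives one inclusion for every
  flag.\<close>

lemma facet_of_r:
  assumes "\<Phi> \<in> flags K"
  shows "facet_of K (r \<Phi>) = r ` facet_of K \<Phi>"
proof -
  have sub: "r ` facet_of K \<Phi> \<subseteq> facet_of K (r \<Phi>)" if "\<Phi> \<in> flags K" for \<Phi>
  proof (rule image_subsetI)
    fix \<Psi> assume "\<Psi> \<in> facet_of K \<Phi>"
    then show "r \<Psi> \<in> facet_of K (r \<Phi>)"
      unfolding facet_of_def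
    proof (induction rule: component_induct)
      case base
      show ?case by (rule component_refl)
    next
      case (step \<Psi> i)
      then show ?case
        using r_commutes[of i \<Psi>] r_closed[of \<Psi>] K.rank_eq by (auto intro!: component_step)
    qed
  qed
  \<comment> \<open>The reverse inclusion is the first one at \<open>r \<Phi>\<close>, moved back by
    the involution \<open>r\<close>.\<close>
  have "r ` r ` facet_of K (r \<Phi>) \<subseteq> r ` facet_of K \<Phi>"
    using sub[OF r_closed[OF assms]] r_invol[OF assms] by auto
  moreover have "r ` r ` facet_of K (r \<Phi>) = facet_of K (r \<Phi>)"
    using K.facet_of_subset[OF r_closed[OF assms]] r_invol by (force simp: image_image)
  ultimately show ?thesis using sub[OF assms] by auto
qed

text \<open>By \<open>facet_of_r\<close> the way back is labelled by \<xi> of the image facet, which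
  \<open>xi_inv\<close> makes the inverse label, so the two labels cancel.\<close>

lemma D_adj_top_invol:
  assumes "\<Phi> \<in> flags K" "\<gamma> \<in> carrier G"
  shows "adj D n (adj D n (\<Phi>, \<gamma>)) = (\<Phi>, \<gamma>)"
proof -
  have "\<xi> (facet_of K (r \<Phi>)) = inv (\<xi> (facet_of K \<Phi>))"
    using xi_inv[of "facet_of K \<Phi>"] assms by (simp add: facet_of_r facets_def)
  then show ?thesis
    using assms r_invol xi_facet_closed by (simp add: D_adj_top flip: G.m_assoc)
qed

lemma D_adj_top_commutes:
  assumes "i + 1 < n" "\<Phi> \<in> flags K"
  shows "adj D n (adj D i (\<Phi>, \<gamma>)) = adj D i (adj D n (\<Phi>, \<gamma>))"
  using assms by (simp add: D_adj_top D_adj_less r_commutes K.facet_of_adj)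

lemma premaniplex_D: "premaniplex (n + 1) D"
proof
  show "rank D = n + 1" by (rule D_rank)
next
  fix i x assume i: "i < n + 1" and x: "x \<in> flags D"
  show "adj D i x \<in> flags D"
    using i x K.adj_closed r_closed xi_facet_closed
    by (cases "i = n") (auto simp: D_flags D_adj_less D_adj_top)
  show "adj D i (adj D i x) = x"
    using i x K.adj_invol D_adj_top_invol
    by (cases "i = n") (auto simp: D_flags D_adj_less)
next
  fix i j x
  assume ij: "i < n + 1" "j < n + 1" "\<bar>int i - int j\<bar> > 1" and "x \<in> flags D"
  then obtain \<Phi> \<gamma> where x: "x = (\<Phi>, \<gamma>)" "\<Phi> \<in> flags K" "\<gamma> \<in> carrier G"
    by (auto simp: D_flags)
  \<comment> \<open>If one colour is \<open>n\<close>, the other is at most \<open>n - 2\<close>,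
    exactly the range covered by \<open>D_adj_top_commutes\<close>; the two involutions then
    cancel.\<close>
  consider "i < n" "j < n" | "i = n" "j + 1 < n" | "j = n" "i + 1 < n"
    using ij by linarith
  then show "adj D i (adj D j (adj D i (adj D j x))) = x"
  proof cases
    case 1
    then show ?thesis using ij x K.adj_far by (simp add: D_adj_less)
  next
    case 2
    have "adj D n (adj D j (adj D n (adj D j x))) = adj D n (adj D n (adj D j (adj D j x)))"
      using 2 x K.adj_closed[of j \<Phi>] D_adj_top_commutes[of j "adj K j \<Phi>" \<gamma>]
      by (simp add: D_adj_less)
    then show ?thesis
      using 2 x K.adj_invol[of j \<Phi>] D_adj_top_invol by (simp add: D_adj_less)
  next
    case 3
    have "adj D i (adj D n (adj D i (adj D n x))) = adj D i (adj D i (adj D n (adj D n x)))"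
      using 3 x r_closed D_adj_top_commutes[of i "r \<Phi>"] by (simp add: D_adj_top)
    then show ?thesis
      using 3 x K.adj_invol[of i \<Phi>] D_adj_top_invol by (simp add: D_adj_less)
  qed
qed

section \<open>Right translations by group elements\<close>

definition translation :: "'g \<Rightarrow> 'a \<times> 'g \<Rightarrow> 'a \<times> 'g" where
  "translation \<delta> = (\<lambda>(\<Phi>, \<gamma>)\<in>flags D. (\<Phi>, \<gamma> \<otimes> \<delta>))"

lemma translation_apply:
  "\<lbrakk>\<Phi> \<in> flags K; \<gamma> \<in> carrier G\<rbrakk> \<Longrightarrow> translation \<delta> (\<Phi>, \<gamma>) = (\<Phi>, \<gamma> \<otimes> \<delta>)"
  by (simp add: translation_def D_flags)

text \<open>Colour \<open>n\<close> multiplies the group coordinate on the left, a translation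
  multiplies it on the right, and the two commute by associativity.\<close>

lemma translation_aut:
  assumes "\<delta> \<in> carrier G"
  shows "translation \<delta> \<in> carrier (\<Gamma> D)"
proof -
  have "bij_betw (translation \<delta>) (flags D) (flags D)"
    using assms by (intro bij_betw_byWitness[where f' = "translation (inv \<delta>)"])
      (auto simp: D_flags translation_apply G.m_assoc)
  moreover have "translation \<delta> (adj D i (\<Phi>, \<gamma>)) = adj D i (translation \<delta> (\<Phi>, \<gamma>))"
    if "i < n + 1" "\<Phi> \<in> flags K" "\<gamma> \<in> carrier G" for i \<Phi> \<gamma>
    using that assms K.adj_closed r_closed xi_facet_closed
    by (cases "i = n") (auto simp: D_adj_less D_adj_top translation_apply G.m_assoc)
  moreover have "translation \<delta> \<in> extensional (flags D)"
    by (simp add: translation_def)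
  ultimately show ?thesis
    by (auto simp: aut_group_def iso_graph_def D_rank D_flags)
qed

section \<open>The action of an automorphism on a single layer\<close>

definition layer_map :: "('a \<times> 'g \<Rightarrow> 'a \<times> 'g) \<Rightarrow> 'g \<Rightarrow> 'a \<Rightarrow> 'a" where
  "layer_map \<sigma> \<gamma> = (\<lambda>\<Phi>\<in>flags K. fst (\<sigma> (\<Phi>, \<gamma>)))"

lemma aut_D_closed:
  assumes "\<sigma> \<in> carrier (\<Gamma> D)" "\<Phi> \<in> flags K" "\<gamma> \<in> carrier G"
  shows "\<sigma> (\<Phi>, \<gamma>) \<in> flags K \<times> carrier G"
  using aut_closed[OF assms(1), of "(\<Phi>, \<gamma>)"] assms by (simp add: D_flags)

lemma layer_map_closed:
  "\<lbrakk>\<sigma> \<in> carrier (\<Gamma> D); \<Phi> \<in> flags K; \<gamma> \<in> carrier G\<rbrakk> \<Longrightarrow> layer_map \<sigma> \<gamma> \<Phi> \<in> flags K"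
  using aut_D_closed[of \<sigma> \<Phi> \<gamma>] by (auto simp: layer_map_def)

lemma aut_D_adj:
  assumes "\<sigma> \<in> carrier (\<Gamma> D)" "i < n" "\<Phi> \<in> flags K" "\<gamma> \<in> carrier G"
  shows "\<sigma> (adj K i \<Phi>, \<gamma>) = (adj K i (fst (\<sigma> (\<Phi>, \<gamma>))), snd (\<sigma> (\<Phi>, \<gamma>)))"
  using aut_adj[OF assms(1), of i "(\<Phi>, \<gamma>)"] assms(2-)
  by (simp add: D_rank D_flags D_adj_less flip: D_adj_less)

lemma layer_map_adj:
  "\<lbrakk>\<sigma> \<in> carrier (\<Gamma> D); i < n; \<Phi> \<in> flags K; \<gamma> \<in> carrier G\<rbrakk>
    \<Longrightarrow> layer_map \<sigma> \<gamma> (adj K i \<Phi>) = adj K i (layer_map \<sigma> \<gamma> \<Phi>)"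
  by (simp add: layer_map_def aut_D_adj K.adj_closed)

text \<open>Colours below \<open>n\<close> connect \<open>K\<close> and fix the group coordinate in
  the derived graph. As \<sigma> respects these colours, it sends a whole layer into one layer,
  which can be read off at any flag.\<close>

lemma snd_aut_D:
  assumes "\<sigma> \<in> carrier (\<Gamma> D)" "\<Phi> \<in> flags K" "\<Psi> \<in> flags K" "\<gamma> \<in> carrier G"
  shows "snd (\<sigma> (\<Psi>, \<gamma>)) = snd (\<sigma> (\<Phi>, \<gamma>))"
proof -
  have "\<Psi> \<in> component K {..<n} \<Phi>" using K.connected assms by blast
  then show ?thesis
    by (induction rule: component_induct) (use assms in \<open>auto simp: aut_D_adj\<close>)
qed

text \<open>Injectivity comes from that of \<sigma>: images of one layer share their group
  coordinate, so equal first coordinates mean equal flags. Surjectivity comes from connectedness: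
  the image is nonempty and closed under adjacency.\<close>

lemma layer_map_aut:
  assumes s: "\<sigma> \<in> carrier (\<Gamma> D)" and g: "\<gamma> \<in> carrier G"
  shows "layer_map \<sigma> \<gamma> \<in> carrier (\<Gamma> K)"
proof -
  have inj: "inj_on \<sigma> (flags K \<times> carrier G)"
    using s by (auto simp: aut_group_def iso_graph_def bij_betw_def D_flags)
  have "inj_on (layer_map \<sigma> \<gamma>) (flags K)"
  proof (rule inj_onI)
    fix \<Phi> \<Psi> assume f: "\<Phi> \<in> flags K" "\<Psi> \<in> flags K" and "layer_map \<sigma> \<gamma> \<Phi> = layer_map \<sigma> \<gamma> \<Psi>"
    then have "\<sigma> (\<Phi>, \<gamma>) = \<sigma> (\<Psi>, \<gamma>)"
      using snd_aut_D[OF s f(2,1) g] by (simp add: layer_map_def prod_eq_iff)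
    then show "\<Phi> = \<Psi>"
      using inj_onD[OF inj, of "(\<Phi>, \<gamma>)" "(\<Psi>, \<gamma>)"] f g by simp
  qed
  moreover have "layer_map \<sigma> \<gamma> ` flags K = flags K"
  proof
    show "layer_map \<sigma> \<gamma> ` flags K \<subseteq> flags K" using layer_map_closed s g by blast
    obtain \<Phi> where f: "\<Phi> \<in> flags K" using K.flags_nonempty by auto
    show "flags K \<subseteq> layer_map \<sigma> \<gamma> ` flags K"
    proof
      fix \<Psi> assume "\<Psi> \<in> flags K"
      then have "\<Psi> \<in> component K {..<n} (layer_map \<sigma> \<gamma> \<Phi>)"
        using K.connected layer_map_closed[OF s f g] by blast
      then show "\<Psi> \<in> layer_map \<sigma> \<gamma> ` flags K"
      proof (induction rule: component_induct)
        case base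
        then show ?case using f by simp
      next
        case (step \<Psi> i)
        then obtain X where "X \<in> flags K" "\<Psi> = layer_map \<sigma> \<gamma> X" by blast
        with step(2) show ?case
          using layer_map_adj[OF s _ _ g, of i X] K.adj_closed[of i X]
          by (intro image_eqI[where x = "adj K i X"]) auto
      qed
    qed
  qed
  moreover have "layer_map \<sigma> \<gamma> \<in> extensional (flags K)" by (simp add: layer_map_def)
  ultimately show ?thesis
    using layer_map_adj[OF s _ _ g] K.rank_eq
    by (simp add: aut_group_def iso_graph_def bij_betw_def)
qed

section \<open>The layer actions form a friendly subgroup\<close>

definition layer_group :: "('a \<Rightarrow> 'a) set" where
  "layer_group = {layer_map \<sigma> \<gamma> | \<sigma> \<gamma>. \<sigma> \<in> carrier (\<Gamma> D) \<and> \<gamma> \<in> carrier G}"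

lemma aut_D_mult_closed:
  "\<lbrakk>\<sigma> \<in> carrier (\<Gamma> D); \<tau> \<in> carrier (\<Gamma> D)\<rbrakk> \<Longrightarrow> \<sigma> \<otimes>\<^bsub>\<Gamma> D\<^esub> \<tau> \<in> carrier (\<Gamma> D)"
  using group_aut_group[OF premaniplex_D]
  by (metis group.is_monoid monoid.m_closed)

lemma layer_group_any_layer:
  assumes "h \<in> layer_group" "\<delta> \<in> carrier G"
  obtains \<sigma> where "\<sigma> \<in> carrier (\<Gamma> D)" "h = layer_map \<sigma> \<delta>"
proof -
  obtain \<sigma> \<gamma> where s: "\<sigma> \<in> carrier (\<Gamma> D)" "\<gamma> \<in> carrier G" and h: "h = layer_map \<sigma> \<gamma>"
    using assms(1) by (auto simp: layer_group_def)
  let ?t = "translation (inv \<delta> \<otimes> \<gamma>)"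
  have t: "?t \<in> carrier (\<Gamma> D)" using s assms by (simp add: translation_aut)
  have "\<delta> \<otimes> (inv \<delta> \<otimes> \<gamma>) = \<gamma>" using s assms by (simp flip: G.m_assoc)
  then have "h = layer_map (?t \<otimes>\<^bsub>\<Gamma> D\<^esub> \<sigma>) \<delta>"
    using assms(2) unfolding h layer_map_def
    by (intro restrict_ext) (simp add: aut_mult_apply D_flags translation_apply)
  then show ?thesis using that aut_D_mult_closed[OF t s(1)] by blast
qed

text \<open>The second factor acts on the layer in which \<sigma> lands. By \<open>snd_aut_D\<close>
  the flag \<Phi> serves only to name that layer.\<close>

lemma layer_map_mult:
  assumes "\<sigma> \<in> carrier (\<Gamma> D)" "\<tau> \<in> carrier (\<Gamma> D)" "\<Phi> \<in> flags K" "\<gamma> \<in> carrier G"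
  shows "layer_map (\<sigma> \<otimes>\<^bsub>\<Gamma> D\<^esub> \<tau>) \<gamma> = layer_map \<sigma> \<gamma> \<otimes>\<^bsub>\<Gamma> K\<^esub> layer_map \<tau> (snd (\<sigma> (\<Phi>, \<gamma>)))"
proof (rule extensionalityI[where A = "flags K"])
  show "layer_map (\<sigma> \<otimes>\<^bsub>\<Gamma> D\<^esub> \<tau>) \<gamma> \<in> extensional (flags K)" by (simp add: layer_map_def)
  show "layer_map \<sigma> \<gamma> \<otimes>\<^bsub>\<Gamma> K\<^esub> layer_map \<tau> (snd (\<sigma> (\<Phi>, \<gamma>))) \<in> extensional (flags K)"
    by (simp add: aut_group_def)
  fix \<Psi> assume "\<Psi> \<in> flags K"
  moreover have "snd (\<sigma> (\<Phi>, \<gamma>)) = snd (\<sigma> (\<Psi>, \<gamma>))"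
    using assms(1) \<open>\<Psi> \<in> flags K\<close> assms(3,4) by (rule snd_aut_D)
  moreover have "fst (\<sigma> (\<Psi>, \<gamma>)) \<in> flags K"
    using aut_D_closed[OF assms(1) \<open>\<Psi> \<in> flags K\<close> assms(4)] by auto
  ultimately show "layer_map (\<sigma> \<otimes>\<^bsub>\<Gamma> D\<^esub> \<tau>) \<gamma> \<Psi>
      = (layer_map \<sigma> \<gamma> \<otimes>\<^bsub>\<Gamma> K\<^esub> layer_map \<tau> (snd (\<sigma> (\<Phi>, \<gamma>)))) \<Psi>"
    using assms by (simp add: aut_mult_apply D_flags layer_map_def)
qed

lemma layer_map_one: "\<gamma> \<in> carrier G \<Longrightarrow> layer_map \<one>\<^bsub>\<Gamma> D\<^esub> \<gamma> = \<one>\<^bsub>\<Gamma> K\<^esub>"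
  by (auto simp: layer_map_def aut_group_def D_flags)

lemma subgroup_layer_group: "subgroup layer_group (\<Gamma> K)"
proof -
  interpret GK: group "\<Gamma> K" by (rule group_aut_group[OF K.premaniplex_axioms])
  interpret GD: group "\<Gamma> D" by (rule group_aut_group[OF premaniplex_D])
  obtain \<Phi> where f: "\<Phi> \<in> flags K" using K.flags_nonempty by auto
  have snd_closed: "snd (\<sigma> (\<Phi>, \<gamma>)) \<in> carrier G" if "\<sigma> \<in> carrier (\<Gamma> D)" "\<gamma> \<in> carrier G" for \<sigma> \<gamma>
    using aut_D_closed[OF that(1) f that(2)] by auto
  show ?thesis
  proof (rule GK.subgroupI)
    show "layer_group \<subseteq> carrier (\<Gamma> K)"
      by (auto simp: layer_group_def layer_map_aut)
    have "layer_map \<one>\<^bsub>\<Gamma> D\<^esub> \<one> \<in> layer_group" unfolding layer_group_def by blast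
    then show "layer_group \<noteq> {}" by blast
  next
    fix a assume "a \<in> layer_group"
    then obtain \<sigma> \<gamma> where s: "\<sigma> \<in> carrier (\<Gamma> D)" "\<gamma> \<in> carrier G" and a: "a = layer_map \<sigma> \<gamma>"
      by (auto simp: layer_group_def)
    \<comment> \<open>The inverse automorphism has to be read on the layer to which \<sigma> sends
      layer \<gamma>.\<close>
    let ?b = "layer_map (inv\<^bsub>\<Gamma> D\<^esub> \<sigma>) (snd (\<sigma> (\<Phi>, \<gamma>)))"
    have "a \<otimes>\<^bsub>\<Gamma> K\<^esub> ?b = \<one>\<^bsub>\<Gamma> K\<^esub>"
      using layer_map_mult[OF s(1) GD.inv_closed[OF s(1)] f s(2)] s
      by (simp add: a layer_map_one)
    moreover have "?b \<in> carrier (\<Gamma> K)" "a \<in> carrier (\<Gamma> K)"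
      using layer_map_aut s snd_closed by (simp_all add: a)
    \<comment> \<open>The product computed above makes \<open>a\<close> the inverse of
      \<open>?b\<close>; inverting once more gives the claim.\<close>
    ultimately have "inv\<^bsub>\<Gamma> K\<^esub> a = ?b"
      using GK.inv_equality GK.inv_inv by metis
    then show "inv\<^bsub>\<Gamma> K\<^esub> a \<in> layer_group"
      using s snd_closed unfolding layer_group_def by blast
  next
    fix a b assume "a \<in> layer_group" and b: "b \<in> layer_group"
    then obtain \<sigma> \<gamma> where s: "\<sigma> \<in> carrier (\<Gamma> D)" "\<gamma> \<in> carrier G" and a: "a = layer_map \<sigma> \<gamma>"
      by (auto simp: layer_group_def)
    \<comment> \<open>Realising \<open>b\<close> on the layer where \<sigma> lands makes the two
      automorphisms composable layer by layer.\<close>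
    obtain \<tau> where t: "\<tau> \<in> carrier (\<Gamma> D)" "b = layer_map \<tau> (snd (\<sigma> (\<Phi>, \<gamma>)))"
      using layer_group_any_layer[OF b snd_closed[OF s]] .
    then have "a \<otimes>\<^bsub>\<Gamma> K\<^esub> b = layer_map (\<sigma> \<otimes>\<^bsub>\<Gamma> D\<^esub> \<tau>) \<gamma>"
      using layer_map_mult s f a by simp
    then show "a \<otimes>\<^bsub>\<Gamma> K\<^esub> b \<in> layer_group"
      using s t aut_D_mult_closed unfolding layer_group_def by blast
  qed
qed

text \<open>The edge of colour \<open>n\<close> at (\<Phi>, \<gamma>) ends over
  \<open>r \<Phi>\<close>, in a layer shifted by \<xi> of the facet. As \<sigma> respects this edge,
  the required partner of \<tau> at \<Phi> is the action of the same \<sigma> on the shifted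
  layer.\<close>

lemma friendly_layer_group: "friendly K r layer_group"
  unfolding friendly_def
proof (intro conjI ballI)
  show "layer_group \<subseteq> carrier (\<Gamma> K)"
    using subgroup_layer_group by (rule subgroup.subset)
next
  fix \<Phi> \<tau> assume f: "\<Phi> \<in> flags K" and "\<tau> \<in> layer_group"
  then obtain \<sigma> \<gamma> where s: "\<sigma> \<in> carrier (\<Gamma> D)" "\<gamma> \<in> carrier G" and t: "\<tau> = layer_map \<sigma> \<gamma>"
    by (auto simp: layer_group_def)
  let ?\<delta> = "\<xi> (facet_of K \<Phi>) \<otimes> \<gamma>"
  have "\<sigma> (r \<Phi>, ?\<delta>) = adj D n (\<sigma> (\<Phi>, \<gamma>))"
    using aut_adj[OF s(1), of n "(\<Phi>, \<gamma>)"] f s by (simp add: D_rank D_flags D_adj_top)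
  then have "fst (\<sigma> (r \<Phi>, ?\<delta>)) = r (fst (\<sigma> (\<Phi>, \<gamma>)))"
    by (metis D_adj_top fst_conv prod.collapse)
  then have "r (\<tau> \<Phi>) = layer_map \<sigma> ?\<delta> (r \<Phi>)"
    using f r_closed by (simp add: t layer_map_def)
  moreover have "layer_map \<sigma> ?\<delta> \<in> layer_group"
    using s f xi_facet_closed unfolding layer_group_def by blast
  ultimately show "\<exists>\<tau>'\<in>layer_group. r (\<tau> \<Phi>) = \<tau>' (r \<Phi>)" by blast
qed

section \<open>Flag orbits and the symmetry type graph\<close>

lemma fst_orb:
  assumes "\<Phi> \<in> flags K" "\<gamma> \<in> carrier G"
  shows "fst ` orb (carrier (\<Gamma> D)) (\<Phi>, \<gamma>) = orb layer_group \<Phi>"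
proof -
  \<comment> \<open>Layer \<gamma> alone yields the whole group, so a single orbit upstairs projects
    onto a full orbit in \<open>K\<close>.\<close>
  have "layer_group = (\<lambda>\<sigma>. layer_map \<sigma> \<gamma>) ` carrier (\<Gamma> D)"
    using assms(2) by (auto elim: layer_group_any_layer) (auto simp: layer_group_def)
  then show ?thesis
    using assms(1) by (simp add: orb_def image_image layer_map_def)
qed

text \<open>Equal orbits in \<open>K\<close> give an automorphism taking (\<Phi>, \<gamma>) to some
  flag over \<Psi>, perhaps in the wrong layer; a translation then corrects the layer. This is the
  injectivity of the projection on orbits.\<close>

lemma orb_D_eqI:
  assumes f: "\<Phi> \<in> flags K" "\<gamma> \<in> carrier G" "\<Psi> \<in> flags K" "\<delta> \<in> carrier G"
    and eq: "orb layer_group \<Phi> = orb layer_group \<Psi>"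
  shows "orb (carrier (\<Gamma> D)) (\<Phi>, \<gamma>) = orb (carrier (\<Gamma> D)) (\<Psi>, \<delta>)"
proof -
  interpret GD: group "\<Gamma> D" by (rule group_aut_group[OF premaniplex_D])
  note orb_D = orb_trans[OF premaniplex_D GD.subgroup_self]
  have "\<one>\<^bsub>\<Gamma> K\<^esub> \<in> layer_group" using subgroup_layer_group by (rule subgroup.one_closed)
  then have "\<Psi> \<in> orb layer_group \<Psi>"
    using f(3) by (auto simp: orb_def aut_one_apply intro!: image_eqI[where x = "\<one>\<^bsub>\<Gamma> K\<^esub>"])
  then have "\<Psi> \<in> fst ` orb (carrier (\<Gamma> D)) (\<Phi>, \<gamma>)"
    using fst_orb[OF f(1,2)] eq by simp
  then obtain \<sigma> where s: "\<sigma> \<in> carrier (\<Gamma> D)" "\<Psi> = fst (\<sigma> (\<Phi>, \<gamma>))"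
    by (auto simp: orb_def)
  then obtain \<epsilon> where e: "\<sigma> (\<Phi>, \<gamma>) = (\<Psi>, \<epsilon>)" "\<epsilon> \<in> carrier G"
    using aut_D_closed[OF s(1) f(1,2)] by (metis SigmaE fst_conv)
  have "translation (inv \<epsilon> \<otimes> \<delta>) (\<Psi>, \<epsilon>) = (\<Psi>, \<delta>)"
    using e f by (simp add: translation_apply flip: G.m_assoc)
  moreover have "translation (inv \<epsilon> \<otimes> \<delta>) \<in> carrier (\<Gamma> D)"
    using e f by (simp add: translation_aut)
  ultimately have "orb (carrier (\<Gamma> D)) (\<Psi>, \<delta>) = orb (carrier (\<Gamma> D)) (\<Psi>, \<epsilon>)"
    using orb_D[of _ "(\<Psi>, \<epsilon>)"] e f by (metis D_flags SigmaI)
  also have "\<dots> = orb (carrier (\<Gamma> D)) (\<Phi>, \<gamma>)"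
    using orb_D[OF s(1), of "(\<Phi>, \<gamma>)"] e f by (simp add: D_flags)
  finally show ?thesis by simp
qed

lemma symmetry_type_graph_derived:
  "symmetry_type_graph D \<simeq> quotient_graph (pre_extension K r) layer_group"
proof -
  let ?Q = "quotient_graph (pre_extension K r) layer_group"
  let ?S = "symmetry_type_graph D"
  interpret GD: group "\<Gamma> D" by (rule group_aut_group[OF premaniplex_D])
  have flags_S: "flags ?S = orb (carrier (\<Gamma> D)) ` (flags K \<times> carrier G)"
    by (simp add: symmetry_type_graph_def quotient_graph_def D_flags)
  \<comment> \<open>Vertices of \<open>?S\<close> are sets of pairs, so the projection to
    \<open>K\<close> acts on them by taking images; \<open>fst_orb\<close> identifies these images
    as vertices of \<open>?Q\<close>.\<close>
  have "iso_graph ?S ?Q (image fst)"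
    unfolding iso_graph_def
  proof (intro conjI allI impI ballI)
    show "rank ?S = rank ?Q"
      by (simp add: symmetry_type_graph_def quotient_graph_def pre_extension_def D_rank K.rank_eq)
    have "inj_on (image fst) (flags ?S)"
    proof (rule inj_onI)
      fix X Y assume "X \<in> flags ?S" "Y \<in> flags ?S" and eq: "fst ` X = fst ` Y"
      then obtain \<Phi> \<gamma> \<Psi> \<delta> where f: "\<Phi> \<in> flags K" "\<gamma> \<in> carrier G" "\<Psi> \<in> flags K" "\<delta> \<in> carrier G"
        and X: "X = orb (carrier (\<Gamma> D)) (\<Phi>, \<gamma>)" and Y: "Y = orb (carrier (\<Gamma> D)) (\<Psi>, \<delta>)"
        unfolding flags_S by blast
      have "orb layer_group \<Phi> = orb layer_group \<Psi>"
        using eq f by (simp add: X Y fst_orb)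
      with f show "X = Y" unfolding X Y by (rule orb_D_eqI)
    qed
    moreover have "image fst ` flags ?S = flags ?Q"
    proof -
      have "image fst ` flags ?S = (\<lambda>x. orb layer_group (fst x)) ` (flags K \<times> carrier G)"
        unfolding flags_S image_image
        by (rule image_cong[OF refl]) (metis SigmaE fst_conv fst_orb)
      also have "\<dots> = orb layer_group ` fst ` (flags K \<times> carrier G)"
        by (simp only: image_image)
      also have "\<dots> = orb layer_group ` flags K"
        using G.one_closed by (metis empty_iff fst_image_times)
      finally show ?thesis by (simp add: quotient_graph_def pre_extension_def)
    qed
    ultimately show "bij_betw (image fst) (flags ?S) (flags ?Q)" by (simp add: bij_betw_def)
  next
    fix i X assume "i < rank ?S" and "X \<in> flags ?S"
    then have i: "i < n + 1"
      by (simp add: symmetry_type_graph_def quotient_graph_def D_rank)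
    obtain \<Phi> \<gamma> where f: "\<Phi> \<in> flags K" "\<gamma> \<in> carrier G"
      and X: "X = orb (carrier (\<Gamma> D)) (\<Phi>, \<gamma>)"
      using \<open>X \<in> flags ?S\<close> unfolding flags_S by blast
    have c: "adj D i (\<Phi>, \<gamma>) \<in> flags K \<times> carrier G"
      using premaniplex.adj_closed[OF premaniplex_D i, of "(\<Phi>, \<gamma>)"] f by (simp add: D_flags)
    have "fst ` adj ?S i X = fst ` orb (carrier (\<Gamma> D)) (adj D i (\<Phi>, \<gamma>))"
      using quotient_graph_adj[OF premaniplex_D GD.subgroup_self, of i "(\<Phi>, \<gamma>)"] i f
      by (simp add: X symmetry_type_graph_def D_rank D_flags)
    also have "\<dots> = orb layer_group (fst (adj D i (\<Phi>, \<gamma>)))"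
      using c fst_orb by (metis SigmaE fst_conv)
    \<comment> \<open>Forgetting the group coordinate maps every edge of the derived graph to the
      edge of the same colour in the pre-extension.\<close>
    also have "fst (adj D i (\<Phi>, \<gamma>)) = adj (pre_extension K r) i \<Phi>"
      by (simp add: derived_maniplex_def pre_extension_def)
    \<comment> \<open>For colour \<open>n\<close> this is where friendliness enters: it makes the
      orbit of \<open>r \<Phi>\<close> depend only on the orbit of \<Phi>.\<close>
    also have "orb layer_group (adj (pre_extension K r) i \<Phi>) = adj ?Q i (orb layer_group \<Phi>)"
      using quotient_pre_extension_adj[OF subgroup_layer_group friendly_layer_group, of i \<Phi>] i f
      by simp
    also have "orb layer_group \<Phi> = fst ` X" using f by (simp add: X fst_orb)
    finally show "fst ` adj ?S i X = adj ?Q i (fst ` X)" .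
  qed
  then show ?thesis unfolding isomorphic_graphs_def by blast
qed

end

theorem theorem5p18:
  fixes K :: "'a coloured_graph" and G :: "('g, 'm) monoid_scheme"
  assumes "cayley_extender n K r G \<xi>"
  shows "\<exists>H. subgroup H (\<Gamma> K) \<and> friendly K r H \<and> H \<subseteq> \<heartsuit> K r \<and>
    symmetry_type_graph (derived_maniplex K r G \<xi>) \<simeq> quotient_graph (pre_extension K r) H"
proof -
  interpret cayley_extender n K r G \<xi> by fact
  have "layer_group \<subseteq> \<heartsuit> K r" using friendly_layer_group by (auto simp: heart_def)
  then show ?thesis
    using subgroup_layer_group friendly_layer_group symmetry_type_graph_derived by blast
qed

end
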